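(* A Finsler space $(M,L)$ satisfying the b-condition $b^iC_{ijk}=0$ is Riemannian if and only if its T-tensor $T_{hijk}$ vanishes.
   Context: $(M,L)$ is an $n$-dimensional smooth Finsler manifold; $\dot\partial_i=\partial/\partial y^i$, $g_{ij}=\frac12\dot\partial_i\dot\partial_jL^2$, $l_i=\dot\partial_iL$, $y_i=g_{ij}y^j$, $C_{ijk}=\frac12\dot\partial_kg_{ij}$, $C^i_{jk}=g^{ir}C_{rjk}$; $(M,L)$ is Riemannian if $C_{ijk}=0$. The vertical covariant derivative (Cartan connection) is $C_{hij}|_k=\dot\partial_kC_{hij}-C_{mij}C^m_{hk}-C_{hmj}C^m_{ik}-C_{him}C^m_{jk}$, and the T-tensor is $$T_{hijk}=L\,C_{hij}|_k+C_{hij}l_k+C_{hik}l_j+C_{hjk}l_i+C_{ijk}l_h.$$ A 1-form $b_i(x)dx^i$ on $M$ is given, with $\beta=b_iy^i$, $b^i=g^{ij}b_j$, and it is assumed that $m_i:=b_i-(\beta/L^2)y_i\neq0$ and $m^2:=g^{ij}m_im_j\ne0$ at the points under consideration (in particular $b_i(x)$ is nowhere zero on $M$). *)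

theory Defs
  imports "HOL-Analysis.Analysis"
begin

section \<open>Smooth maps and smooth manifolds\<close>

primrec Ck_on :: "nat \<Rightarrow> 'e::real_normed_vector set \<Rightarrow> ('e \<Rightarrow> 'f::real_normed_vector) \<Rightarrow> bool" where
  "Ck_on 0 S f \<longleftrightarrow> continuous_on S f"
| "Ck_on (Suc k) S f \<longleftrightarrow>
     (\<forall>x\<in>S. f differentiable (at x)) \<and> (\<forall>v. Ck_on k S (\<lambda>x. frechet_derivative f (at x) v))"

text \<open>Only used on open sets \<open>S\<close>.\<close>

definition smooth_on :: "'e::real_normed_vector set \<Rightarrow> ('e \<Rightarrow> 'f::real_normed_vector) \<Rightarrow> bool" where
  "smooth_on S f \<longleftrightarrow> (\<forall>k. Ck_on k S f)"

text \<open>A chart \<open>(U, \<phi>)\<close> of an \<open>n\<close>-dimensional manifold, \<open>n = CARD('n)\<close>; the values of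
  \<open>\<phi>\<close> outside \<open>U\<close> are irrelevant.\<close>

type_synonym ('a, 'n) chart = "'a set \<times> ('a \<Rightarrow> (real, 'n) vec)"

definition chart_inv :: "('a, 'n::finite) chart \<Rightarrow> real^'n \<Rightarrow> 'a" where
  "chart_inv c = inv_into (fst c) (snd c)"

definition transition :: "('a, 'n::finite) chart \<Rightarrow> ('a, 'n) chart \<Rightarrow> real^'n \<Rightarrow> real^'n" where
  "transition c c' = snd c' \<circ> chart_inv c"

text \<open>The atlas need not be maximal.\<close>

definition smooth_manifold :: "'a topology \<Rightarrow> ('a, 'n::finite) chart set \<Rightarrow> bool" where
  "smooth_manifold M \<A> \<longleftrightarrow>
     Hausdorff_space M \<and> second_countable M \<and>
     (\<forall>(U, \<phi>)\<in>\<A>. openin M U \<and> open (\<phi> ` U) \<and>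
        homeomorphic_map (subtopology M U) (top_of_set (\<phi> ` U)) \<phi>) \<and>
     (\<Union>c\<in>\<A>. fst c) = topspace M \<and>
     (\<forall>c\<in>\<A>. \<forall>c'\<in>\<A>. smooth_on (snd c ` (fst c \<inter> fst c')) (transition c c'))"

definition charts_at :: "('a, 'n::finite) chart set \<Rightarrow> 'a \<Rightarrow> ('a, 'n) chart set" where
  "charts_at \<A> p = {c\<in>\<A>. p \<in> fst c}"

text \<open>The Jacobian at \<open>p\<close> of the coordinate change from \<open>c\<close> to \<open>c'\<close>.\<close>

definition jac :: "('a, 'n::finite) chart \<Rightarrow> ('a, 'n) chart \<Rightarrow> 'a \<Rightarrow> real^'n \<Rightarrow> real^'n" where
  "jac c c' p = frechet_derivative (transition c c') (at (snd c p))"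

text \<open>A tangent vector at \<open>p\<close> is the family of its component vectors in the charts at \<open>p\<close>,
  subject to the contravariant transformation law; it is set to \<open>0\<close> at all other charts so
  that equality of tangent vectors is equality of functions.\<close>

type_synonym ('a, 'n) tvec = "('a, 'n) chart \<Rightarrow> (real, 'n) vec"

definition tangent_space :: "('a, 'n::finite) chart set \<Rightarrow> 'a \<Rightarrow> ('a, 'n) tvec set" where
  "tangent_space \<A> p =
     {v. (\<forall>c\<in>charts_at \<A> p. \<forall>c'\<in>charts_at \<A> p. v c' = jac c c' p (v c)) \<and>
         (\<forall>c. c \<notin> charts_at \<A> p \<longrightarrow> v c = 0)}"

definition slit_tangent_bundle ::
  "'a topology \<Rightarrow> ('a, 'n::finite) chart set \<Rightarrow> ('a \<times> ('a, 'n) tvec) set" where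
  "slit_tangent_bundle M \<A> =
     {(p, v). p \<in> topspace M \<and> v \<in> tangent_space \<A> p \<and> v \<noteq> (\<lambda>_. 0)}"

text \<open>The tangent vector at \<open>p\<close> with components \<open>y\<close> in the chart \<open>c\<close>.\<close>

definition tvec_of ::
  "('a, 'n::finite) chart set \<Rightarrow> ('a, 'n) chart \<Rightarrow> 'a \<Rightarrow> real^'n \<Rightarrow> ('a, 'n) tvec" where
  "tvec_of \<A> c p y = (\<lambda>c'. if c' \<in> charts_at \<A> p then jac c c' p y else 0)"

text \<open>A 1-form is given by its component vectors \<open>b p c = (b\<^sub>1, \<dots>, b\<^sub>n)\<close> at \<open>p\<close> in the charts
  \<open>c\<close> at \<open>p\<close>, subject to the covariant transformation law.\<close>

definition smooth_one_form ::
  "('a, 'n::finite) chart set \<Rightarrow> ('a \<Rightarrow> ('a, 'n) chart \<Rightarrow> real^'n) \<Rightarrow> bool" where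
  "smooth_one_form \<A> b \<longleftrightarrow>
     (\<forall>p. \<forall>c\<in>charts_at \<A> p. \<forall>c'\<in>charts_at \<A> p. \<forall>y. b p c' \<bullet> jac c c' p y = b p c \<bullet> y) \<and>
     (\<forall>c\<in>\<A>. smooth_on (snd c ` fst c) (\<lambda>x. b (chart_inv c x) c))"


section \<open>Fibrewise objects in coordinates\<close>

text \<open>Here \<open>F\<close> is the function \<open>y \<mapsto> L(x, y)\<close> for a fixed \<open>x\<close>, and \<open>b\<close> is the component vector
  at \<open>x\<close> of the 1-form.\<close>

definition vd :: "'n \<Rightarrow> (real^'n \<Rightarrow> real) \<Rightarrow> real^'n \<Rightarrow> real" where
  "vd i f y = frechet_derivative f (at y) (axis i 1)"

definition g_low :: "(real^'n \<Rightarrow> real) \<Rightarrow> 'n \<Rightarrow> 'n \<Rightarrow> real^'n \<Rightarrow> real" where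
  "g_low F i j y = (1/2) * vd i (vd j (\<lambda>z. (F z)\<^sup>2)) y"

definition g_mat :: "(real^'n \<Rightarrow> real) \<Rightarrow> real^'n \<Rightarrow> real^'n^'n" where
  "g_mat F y = (\<chi> i j. g_low F i j y)"

definition g_up :: "(real^'n \<Rightarrow> real) \<Rightarrow> 'n \<Rightarrow> 'n \<Rightarrow> real^'n \<Rightarrow> real" where
  "g_up F i j y = matrix_inv (g_mat F y) $ i $ j"

definition l_low :: "(real^'n \<Rightarrow> real) \<Rightarrow> 'n \<Rightarrow> real^'n \<Rightarrow> real" where
  "l_low F i y = vd i F y"

definition y_low :: "(real^'n \<Rightarrow> real) \<Rightarrow> 'n \<Rightarrow> real^'n \<Rightarrow> real" where
  "y_low F i y = (\<Sum>j\<in>UNIV. g_low F i j y * y $ j)"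

definition C_low :: "(real^'n \<Rightarrow> real) \<Rightarrow> 'n \<Rightarrow> 'n \<Rightarrow> 'n \<Rightarrow> real^'n \<Rightarrow> real" where
  "C_low F i j k y = (1/2) * vd k (g_low F i j) y"

definition C_up :: "(real^'n \<Rightarrow> real) \<Rightarrow> 'n \<Rightarrow> 'n \<Rightarrow> 'n \<Rightarrow> real^'n \<Rightarrow> real" where
  "C_up F i j k y = (\<Sum>r\<in>UNIV. g_up F i r y * C_low F r j k y)"

text \<open>The vertical covariant derivative \<open>C\<^sub>h\<^sub>i\<^sub>j|\<^sub>k\<close> of the Cartan connection.\<close>

definition C_vcov :: "(real^'n \<Rightarrow> real) \<Rightarrow> 'n \<Rightarrow> 'n \<Rightarrow> 'n \<Rightarrow> 'n \<Rightarrow> real^'n \<Rightarrow> real" where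
  "C_vcov F h i j k y =
     vd k (C_low F h i j) y
     - (\<Sum>m\<in>UNIV. C_low F m i j y * C_up F m h k y)
     - (\<Sum>m\<in>UNIV. C_low F h m j y * C_up F m i k y)
     - (\<Sum>m\<in>UNIV. C_low F h i m y * C_up F m j k y)"

definition T_low :: "(real^'n \<Rightarrow> real) \<Rightarrow> 'n \<Rightarrow> 'n \<Rightarrow> 'n \<Rightarrow> 'n \<Rightarrow> real^'n \<Rightarrow> real" where
  "T_low F h i j k y =
     F y * C_vcov F h i j k y
     + C_low F h i j y * l_low F k y + C_low F h i k y * l_low F j y
     + C_low F h j k y * l_low F i y + C_low F i j k y * l_low F h y"

definition b_up :: "(real^'n \<Rightarrow> real) \<Rightarrow> real^'n \<Rightarrow> 'n \<Rightarrow> real^'n \<Rightarrow> real" where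
  "b_up F b i y = (\<Sum>j\<in>UNIV. g_up F i j y * b $ j)"

definition beta :: "real^'n \<Rightarrow> real^'n \<Rightarrow> real" where
  "beta b y = (\<Sum>i\<in>UNIV. b $ i * y $ i)"

definition m_low :: "(real^'n \<Rightarrow> real) \<Rightarrow> real^'n \<Rightarrow> 'n \<Rightarrow> real^'n \<Rightarrow> real" where
  "m_low F b i y = b $ i - beta b y / (F y)\<^sup>2 * y_low F i y"

definition m_sq :: "(real^'n \<Rightarrow> real) \<Rightarrow> real^'n \<Rightarrow> real^'n \<Rightarrow> real" where
  "m_sq F b y = (\<Sum>i\<in>UNIV. \<Sum>j\<in>UNIV. g_up F i j y * m_low F b i y * m_low F b j y)"


section \<open>Finsler spaces\<close>

definition fibre_rep ::
  "('a, 'n::finite) chart set \<Rightarrow> ('a \<Rightarrow> ('a, 'n) tvec \<Rightarrow> real) \<Rightarrow> ('a, 'n) chart \<Rightarrow> 'a \<Rightarrow> real^'n \<Rightarrow> real"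
  where "fibre_rep \<A> L c p y = L p (tvec_of \<A> c p y)"

definition bundle_coords ::
  "('a, 'n::finite) chart set \<Rightarrow> ('a \<times> ('a, 'n) tvec) set \<Rightarrow> ('a, 'n) chart \<Rightarrow> ((real^'n) \<times> (real^'n)) set"
  where "bundle_coords \<A> D c =
     {(x, y). x \<in> snd c ` fst c \<and> (chart_inv c x, tvec_of \<A> c (chart_inv c x) y) \<in> D}"

text \<open>The Finsler function lives on an open conic subset \<open>D\<close> of the slit tangent bundle;
  \<open>D = slit_tangent_bundle M \<A>\<close> is the regular case, in which the metric tensor, being
  nondegenerate with \<open>L > 0\<close>, is automatically positive definite. A proper subset \<open>D\<close> has to
  be allowed in order to exclude the directions in which \<open>m\<^sub>i = 0\<close>.\<close>

definition finsler_space ::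
  "'a topology \<Rightarrow> ('a, 'n::finite) chart set \<Rightarrow> ('a \<times> ('a, 'n) tvec) set
     \<Rightarrow> ('a \<Rightarrow> ('a, 'n) tvec \<Rightarrow> real) \<Rightarrow> bool" where
  "finsler_space M \<A> D L \<longleftrightarrow>
     smooth_manifold M \<A> \<and>
     D \<subseteq> slit_tangent_bundle M \<A> \<and>
     (\<forall>c\<in>\<A>. open (bundle_coords \<A> D c)) \<and>
     (\<forall>c\<in>\<A>. smooth_on (bundle_coords \<A> D c) (\<lambda>(x, y). fibre_rep \<A> L c (chart_inv c x) y)) \<and>
     (\<forall>(p, v)\<in>D. L p v > 0) \<and>
     (\<forall>(p, v)\<in>D. \<forall>t>0. (p, \<lambda>c. t *\<^sub>R v c) \<in> D \<and> L p (\<lambda>c. t *\<^sub>R v c) = t * L p v) \<and>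
     (\<forall>(p, v)\<in>D. \<forall>c\<in>charts_at \<A> p. invertible (g_mat (fibre_rep \<A> L c p) (v c)))"

definition riemannian ::
  "('a, 'n::finite) chart set \<Rightarrow> ('a \<times> ('a, 'n) tvec) set \<Rightarrow> ('a \<Rightarrow> ('a, 'n) tvec \<Rightarrow> real) \<Rightarrow> bool" where
  "riemannian \<A> D L \<longleftrightarrow>
     (\<forall>(p, v)\<in>D. \<forall>c\<in>charts_at \<A> p. \<forall>i j k. C_low (fibre_rep \<A> L c p) i j k (v c) = 0)"

definition T_tensor_vanishes ::
  "('a, 'n::finite) chart set \<Rightarrow> ('a \<times> ('a, 'n) tvec) set \<Rightarrow> ('a \<Rightarrow> ('a, 'n) tvec \<Rightarrow> real) \<Rightarrow> bool" where
  "T_tensor_vanishes \<A> D L \<longleftrightarrow>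
     (\<forall>(p, v)\<in>D. \<forall>c\<in>charts_at \<A> p. \<forall>h i j k. T_low (fibre_rep \<A> L c p) h i j k (v c) = 0)"

definition b_condition ::
  "('a, 'n::finite) chart set \<Rightarrow> ('a \<times> ('a, 'n) tvec) set \<Rightarrow> ('a \<Rightarrow> ('a, 'n) tvec \<Rightarrow> real)
     \<Rightarrow> ('a \<Rightarrow> ('a, 'n) chart \<Rightarrow> real^'n) \<Rightarrow> bool" where
  "b_condition \<A> D L b \<longleftrightarrow>
     (\<forall>(p, v)\<in>D. \<forall>c\<in>charts_at \<A> p. \<forall>j k.
        (\<Sum>i\<in>UNIV. b_up (fibre_rep \<A> L c p) (b p c) i (v c)
                 * C_low (fibre_rep \<A> L c p) i j k (v c)) = 0)"

definition m_nonzero_at ::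
  "('a, 'n::finite) chart set \<Rightarrow> ('a \<Rightarrow> ('a, 'n) tvec \<Rightarrow> real)
     \<Rightarrow> ('a \<Rightarrow> ('a, 'n) chart \<Rightarrow> real^'n) \<Rightarrow> 'a \<Rightarrow> ('a, 'n) tvec \<Rightarrow> bool" where
  "m_nonzero_at \<A> L b p v \<longleftrightarrow>
     (\<forall>c\<in>charts_at \<A> p.
        (\<exists>i. m_low (fibre_rep \<A> L c p) (b p c) i (v c) \<noteq> 0) \<and>
        m_sq (fibre_rep \<A> L c p) (b p c) (v c) \<noteq> 0)"

end

theory Submission
  imports Defs
begin

text \<open>One implication is immediate: the T-tensor is built from \<open>C\<^sub>h\<^sub>i\<^sub>j\<close> and its derivatives along the
  fibres, and the domain of the Finsler function is open in each fibre.

  For the other, the T-tensor is contracted with \<open>b\<^sup>h\<close>. Under the b-condition \<open>b\<^sup>h\<close> has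
  vanishing derivatives along the fibre (lemma \<open>vd_b_up\<close>), because the derivative of \<open>g\<^sub>r\<^sub>h\<close> is \<open>2 C\<^sub>r\<^sub>h\<^sub>k\<close> and \<open>b\<^sub>r\<close> is a
  function of the point alone. So \<open>b\<^sup>h\<close> annihilates not only \<open>C\<^sub>h\<^sub>i\<^sub>j\<close> but also its vertical covariant
  derivative, and since \<open>l\<^sub>h b\<^sup>h = \<beta>/L\<close> what remains is
  \<open>b\<^sup>h T\<^sub>h\<^sub>i\<^sub>j\<^sub>k = (\<beta>/L) C\<^sub>i\<^sub>j\<^sub>k\<close> (lemma \<open>b_T_low\<close>).
  If \<open>T = 0\<close>, then \<open>\<beta> C\<^sub>i\<^sub>j\<^sub>k = 0\<close> in all admissible directions, so \<open>C\<close> vanishes off the hyperplane \<open>\<beta> = 0\<close>;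
  on the hyperplane one differentiates once more, using that \<open>b \<noteq> 0\<close> at every point
  (lemma \<open>T_low_0_imp_C_low_0\<close>).

  The classical facts behind this are Euler's relation, which gives \<open>y\<^sub>h = L l\<^sub>h\<close>, the symmetry of
  second derivatives, which gives \<open>g\<^sub>i\<^sub>j = g\<^sub>j\<^sub>i\<close>, and Cramer's rule, which makes \<open>b\<^sup>h\<close>
  differentiable. Everything takes place in one chart over one point (lemma
  \<open>finsler_fibre_in_chart\<close>).\<close>

section \<open>Closure properties of smooth functions\<close>

lemma frechet_derivative_eq: "(f has_derivative f') (at x) \<Longrightarrow> frechet_derivative f (at x) = f'"
  by (rule frechet_derivative_at[symmetric])

lemma Ck_on_cong:
  fixes f g :: "'e::real_normed_vector \<Rightarrow> 'f::real_normed_vector"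
  assumes "open S" "\<And>x. x \<in> S \<Longrightarrow> f x = g x" "Ck_on k S f"
  shows "Ck_on k S g"
  using assms(2,3)
proof (induction k arbitrary: f g)
  case 0
  then show ?case by (simp cong: continuous_on_cong)
next
  case (Suc k)
  have d: "(g has_derivative frechet_derivative f (at x)) (at x)" if "x \<in> S" for x
    using Suc.prems that assms(1)
    by (intro has_derivative_transform_within_open[of f _ x UNIV S g])
       (auto simp: frechet_derivative_works)
  have "Ck_on k S (\<lambda>x. frechet_derivative g (at x) v)" for v
  proof (rule Suc.IH)
    show "Ck_on k S (\<lambda>x. frechet_derivative f (at x) v)"
      using Suc.prems(2) by simp
  qed (simp add: frechet_derivative_eq[OF d])
  then show ?case
    using d by (auto simp: differentiable_def)
qed

lemma Ck_on_add:
  assumes "open S" "Ck_on k S f" "Ck_on k S g"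
  shows "Ck_on k S (\<lambda>x. f x + g x)"
  using assms(2,3)
proof (induction k arbitrary: f g)
  case 0
  then show ?case by (auto intro: continuous_on_add)
next
  case (Suc k)
  have d: "((\<lambda>x. f x + g x) has_derivative
      (\<lambda>v. frechet_derivative f (at x) v + frechet_derivative g (at x) v)) (at x)" if "x \<in> S" for x
    using Suc.prems that by (intro has_derivative_add) (auto simp: frechet_derivative_works)
  have "Ck_on k S (\<lambda>x. frechet_derivative (\<lambda>x. f x + g x) (at x) v)" for v
  proof (rule Ck_on_cong[OF assms(1)])
    show "Ck_on k S (\<lambda>x. frechet_derivative f (at x) v + frechet_derivative g (at x) v)"
      using Suc.prems by (intro Suc.IH) auto
  qed (simp add: frechet_derivative_eq[OF d])
  then show ?case
    using d by (auto simp: differentiable_def)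
qed

lemma smooth_on_imp_differentiable: "smooth_on S f \<Longrightarrow> x \<in> S \<Longrightarrow> f differentiable (at x)"
  unfolding smooth_on_def by (auto dest: spec[of _ "Suc 0"])

lemma smooth_on_imp_continuous_on: "smooth_on S f \<Longrightarrow> continuous_on S f"
  unfolding smooth_on_def by (auto dest: spec[of _ 0])

lemma smooth_on_frechet_derivative:
  "smooth_on S f \<Longrightarrow> smooth_on S (\<lambda>x. frechet_derivative f (at x) v)"
  unfolding smooth_on_def
proof
  fix k assume "\<forall>k. Ck_on k S f"
  then have "Ck_on (Suc k) S f" by blast
  then show "Ck_on k S (\<lambda>x. frechet_derivative f (at x) v)" by simp
qed

lemma smooth_on_const: "smooth_on S (\<lambda>x. c)"
proof -
  have "Ck_on k S (\<lambda>x. c)" for k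
    by (induction k arbitrary: c) auto
  then show ?thesis by (simp add: smooth_on_def)
qed

lemma smooth_on_mult:
  fixes f g :: "'e::real_normed_vector \<Rightarrow> real"
  assumes "open S" "smooth_on S f" "smooth_on S g"
  shows "smooth_on S (\<lambda>x. f x * g x)"
proof -
  have "Ck_on k S (\<lambda>x. f x * g x)" for k
    using assms(2,3)
  proof (induction k arbitrary: f g)
    case 0
    then show ?case by (auto intro: continuous_on_mult dest: smooth_on_imp_continuous_on)
  next
    case (Suc k)
    have d: "((\<lambda>x. f x * g x) has_derivative
        (\<lambda>v. f x * frechet_derivative g (at x) v + frechet_derivative f (at x) v * g x)) (at x)"
      if "x \<in> S" for x
      using Suc.prems that
      by (intro has_derivative_mult) (auto simp: smooth_on_imp_differentiable simp flip: frechet_derivative_works)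
    have "Ck_on k S (\<lambda>x. frechet_derivative (\<lambda>x. f x * g x) (at x) v)" for v
    proof (rule Ck_on_cong[OF assms(1)])
      show "Ck_on k S (\<lambda>x. f x * frechet_derivative g (at x) v + frechet_derivative f (at x) v * g x)"
        using Suc.prems assms(1) by (intro Ck_on_add Suc.IH smooth_on_frechet_derivative)
    qed (simp add: frechet_derivative_eq[OF d])
    then show ?case
      using d by (auto simp: differentiable_def)
  qed
  then show ?thesis by (simp add: smooth_on_def)
qed

text \<open>Restricting to the slice over \<open>x\<close> leaves only the derivatives in the directions \<open>(0, v)\<close>,
  which are again restrictions of functions of the same kind. This is how a Finsler function,
  smooth on the bundle, becomes a smooth function on each fibre.\<close>

lemma Ck_on_section:
  fixes f :: "'e::real_normed_vector \<times> 'g::real_normed_vector \<Rightarrow> 'f::real_normed_vector"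
  assumes "open S" "Ck_on k S f"
  shows "Ck_on k {y. (x, y) \<in> S} (\<lambda>y. f (x, y))"
  using assms(2)
proof (induction k arbitrary: f)
  case 0
  then have "continuous_on S f" by simp
  moreover have "continuous_on {y. (x, y) \<in> S} (Pair x)"
    by (intro continuous_on_Pair continuous_on_const continuous_on_id)
  ultimately have "continuous_on {y. (x, y) \<in> S} (\<lambda>y. f (x, y))"
    by (rule continuous_on_compose2) auto
  then show ?case by simp
next
  case (Suc k)
  have op: "open {y. (x, y) \<in> S}"
    using open_vimage[OF assms(1), of "Pair x"] by (simp add: vimage_def continuous_on_Pair)
  have d: "((\<lambda>y. f (x, y)) has_derivative (\<lambda>v. frechet_derivative f (at (x, y)) (0, v))) (at y)"
    if "(x, y) \<in> S" for y
  proof -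
    have "(Pair x has_derivative Pair 0) (at y)"
      by (intro has_derivative_Pair has_derivative_const has_derivative_ident)
    moreover have "(f has_derivative frechet_derivative f (at (x, y))) (at (x, y))"
      using Suc.prems that by (simp flip: frechet_derivative_works)
    ultimately show ?thesis by (rule has_derivative_compose)
  qed
  have "Ck_on k {y. (x, y) \<in> S} (\<lambda>z. frechet_derivative (\<lambda>y. f (x, y)) (at z) v)" for v
  proof (rule Ck_on_cong[OF op])
    show "Ck_on k {y. (x, y) \<in> S} (\<lambda>y. frechet_derivative f (at (x, y)) (0, v))"
      using Suc.IH[of "\<lambda>z. frechet_derivative f (at z) (0, v)"] Suc.prems by simp
  qed (simp add: frechet_derivative_eq[OF d])
  then show ?case
    using d by (auto simp: differentiable_def)
qed

section \<open>Symmetry of second derivatives\<close>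

text \<open>The second difference over the parallelogram spanned by \<open>t u\<close> and \<open>t v\<close> does not depend on
  the order of \<open>u\<close> and \<open>v\<close>, yet two applications of the mean value theorem express it by the
  second derivative taken first along \<open>u\<close> and then along \<open>v\<close>. Exchanging the roles of the two
  directions is what makes second derivatives symmetric below.\<close>

lemma second_difference_eq:
  fixes f :: "'e::real_normed_vector \<Rightarrow> real"
  assumes S: "open S" and f: "smooth_on S f" and t: "0 < t"
    and inS: "\<And>a b. 0 \<le> a \<Longrightarrow> a \<le> t \<Longrightarrow> 0 \<le> b \<Longrightarrow> b \<le> t \<Longrightarrow> x + a *\<^sub>R u + b *\<^sub>R v \<in> S"
  obtains a b where "0 \<le> a" "a \<le> t" "0 \<le> b" "b \<le> t"
    "f (x + t *\<^sub>R u + t *\<^sub>R v) - f (x + t *\<^sub>R u) - f (x + t *\<^sub>R v) + f x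
     = t\<^sup>2 * frechet_derivative (\<lambda>z. frechet_derivative f (at z) u) (at (x + a *\<^sub>R u + b *\<^sub>R v)) v"
proof -
  define Du where "Du = (\<lambda>z. frechet_derivative f (at z) u)"
  have lin: "frechet_derivative h (at z) (c *\<^sub>R w) = c * frechet_derivative h (at z) w"
    if "smooth_on S h" "z \<in> S" for h :: "'e \<Rightarrow> real" and z w c
    using linear_frechet_derivative[OF smooth_on_imp_differentiable[OF that]]
    by (simp add: linear_scale)
  have line: "((\<lambda>s. h (p + s *\<^sub>R w)) has_derivative (\<lambda>c. c * frechet_derivative h (at (p + s *\<^sub>R w)) w))
      (at s within A)"
    if "smooth_on S h" "p + s *\<^sub>R w \<in> S" for h :: "'e \<Rightarrow> real" and p w s A
  proof -
    have "((\<lambda>s. p + s *\<^sub>R w) has_derivative (\<lambda>c. c *\<^sub>R w)) (at s within A)"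
      by (auto intro!: derivative_eq_intros)
    from has_derivative_compose[OF this, of h "frechet_derivative h (at (p + s *\<^sub>R w))"] that
    show ?thesis
      by (simp add: lin smooth_on_imp_differentiable flip: frechet_derivative_works)
  qed
  \<comment> \<open>The first step runs along \<open>u\<close>, applied to the difference of \<open>f\<close> on two parallel edges.\<close>
  have "\<exists>a\<in>{0<..<t}. (f ((x + t *\<^sub>R v) + t *\<^sub>R u) - f (x + t *\<^sub>R u))
      - (f ((x + t *\<^sub>R v) + 0 *\<^sub>R u) - f (x + 0 *\<^sub>R u))
      = (t - 0) * Du ((x + t *\<^sub>R v) + a *\<^sub>R u) - (t - 0) * Du (x + a *\<^sub>R u)"
    unfolding Du_def
  proof (rule mvt_simple[OF t])
    fix s assume s: "0 \<le> s" "s \<le> t"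
    show "((\<lambda>s. f ((x + t *\<^sub>R v) + s *\<^sub>R u) - f (x + s *\<^sub>R u)) has_derivative
      (\<lambda>c. c * frechet_derivative f (at ((x + t *\<^sub>R v) + s *\<^sub>R u)) u - c * frechet_derivative f (at (x + s *\<^sub>R u)) u))
      (at s within {0..t})"
      using inS[of s t] inS[of s 0] s t
      by (intro has_derivative_diff line f) (auto simp: add_ac)
  qed
  then obtain a where a: "0 < a" "a < t" and
    1: "f (x + t *\<^sub>R u + t *\<^sub>R v) - f (x + t *\<^sub>R u) - f (x + t *\<^sub>R v) + f x
      = t * (Du (x + a *\<^sub>R u + t *\<^sub>R v) - Du (x + a *\<^sub>R u))"
    by (auto simp: algebra_simps)
  have "\<exists>b\<in>{0<..<t}. Du ((x + a *\<^sub>R u) + t *\<^sub>R v) - Du ((x + a *\<^sub>R u) + 0 *\<^sub>R v)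
      = (t - 0) * frechet_derivative Du (at ((x + a *\<^sub>R u) + b *\<^sub>R v)) v"
    using a inS f t unfolding Du_def
    by (intro mvt_simple line smooth_on_frechet_derivative) auto
  then obtain b where "0 < b" "b < t" "Du (x + a *\<^sub>R u + t *\<^sub>R v) - Du (x + a *\<^sub>R u)
      = t * frechet_derivative Du (at (x + a *\<^sub>R u + b *\<^sub>R v)) v"
    by auto
  with a 1 show thesis
    by (intro that[of a b]) (auto simp: Du_def power2_eq_square)
qed

text \<open>Both iterated derivatives take equal values at two points of any small parallelogram at \<open>x\<close>,
  because both compute the same second difference; continuity moves these values to \<open>x\<close>.\<close>

lemma second_derivative_symmetric:
  fixes f :: "'e::real_normed_vector \<Rightarrow> real"
  assumes S: "open S" and f: "smooth_on S f" and x: "x \<in> S"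
  shows "frechet_derivative (\<lambda>z. frechet_derivative f (at z) u) (at x) v
       = frechet_derivative (\<lambda>z. frechet_derivative f (at z) v) (at x) u"
proof -
  define Duv where "Duv = (\<lambda>u v x. frechet_derivative (\<lambda>z. frechet_derivative f (at z) u) (at x) v)"
  have "continuous_on S (Duv u v)" for u v
    unfolding Duv_def by (intro smooth_on_imp_continuous_on smooth_on_frechet_derivative f)
  then have cont: "continuous (at x) (Duv u v)" for u v
    using S x continuous_on_eq_continuous_at by blast
  have "\<bar>Duv u v x - Duv v u x\<bar> < e + e" if e: "0 < e" for e
  proof -
    obtain d1 where d1: "d1 > 0" "\<And>z. dist z x < d1 \<Longrightarrow> \<bar>Duv u v z - Duv u v x\<bar> < e"
      using cont[of u v] e unfolding continuous_at_eps_delta dist_real_def by blast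
    obtain d2 where d2: "d2 > 0" "\<And>z. dist z x < d2 \<Longrightarrow> \<bar>Duv v u z - Duv v u x\<bar> < e"
      using cont[of v u] e unfolding continuous_at_eps_delta dist_real_def by blast
    obtain d3 where d3: "d3 > 0" "ball x d3 \<subseteq> S"
      using S x open_contains_ball by blast
    define d where "d = min d1 (min d2 d3)"
    \<comment> \<open>Small enough for the whole parallelogram to lie within distance \<open>d\<close> of \<open>x\<close>; the
      summand \<open>1\<close> keeps the denominator positive.\<close>
    define t where "t = d / (norm u + norm v + 1)"
    have d: "d > 0" using d1 d2 d3 by (simp add: d_def)
    have n: "norm u + norm v + 1 > 0"
      by (smt (verit) norm_ge_zero)
    have t: "t > 0" using d n by (simp add: t_def)
    have near: "dist (x + a *\<^sub>R u + b *\<^sub>R v) x < d" if "0 \<le> a" "a \<le> t" "0 \<le> b" "b \<le> t" for a b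
    proof -
      have "dist (x + a *\<^sub>R u + b *\<^sub>R v) x \<le> a * norm u + b * norm v"
        using norm_triangle_ineq[of "a *\<^sub>R u" "b *\<^sub>R v"] that by (simp add: dist_norm add.assoc)
      also have "\<dots> \<le> t * norm u + t * norm v"
        using that by (intro add_mono mult_right_mono) auto
      also have "\<dots> < t * (norm u + norm v + 1)"
        using t by (simp add: algebra_simps)
      finally show ?thesis using n by (simp add: t_def)
    qed
    have inS: "x + a *\<^sub>R u + b *\<^sub>R v \<in> S" if "0 \<le> a" "a \<le> t" "0 \<le> b" "b \<le> t" for a b
      using near[OF that] d3 by (auto simp: d_def dist_commute)
    obtain a b where ab: "0 \<le> a" "a \<le> t" "0 \<le> b" "b \<le> t" and
      1: "f (x + t *\<^sub>R u + t *\<^sub>R v) - f (x + t *\<^sub>R u) - f (x + t *\<^sub>R v) + f x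
        = t\<^sup>2 * Duv u v (x + a *\<^sub>R u + b *\<^sub>R v)"
      unfolding Duv_def by (rule second_difference_eq[OF S f t inS])
    have inS': "x + a *\<^sub>R v + b *\<^sub>R u \<in> S" if "0 \<le> a" "a \<le> t" "0 \<le> b" "b \<le> t" for a b
      using inS[of b a] that by (simp add: add_ac)
    obtain a' b' where ab': "0 \<le> a'" "a' \<le> t" "0 \<le> b'" "b' \<le> t" and
      2: "f (x + t *\<^sub>R v + t *\<^sub>R u) - f (x + t *\<^sub>R v) - f (x + t *\<^sub>R u) + f x
        = t\<^sup>2 * Duv v u (x + a' *\<^sub>R v + b' *\<^sub>R u)"
      unfolding Duv_def by (rule second_difference_eq[OF S f t inS'])
    have "x + t *\<^sub>R v + t *\<^sub>R u = x + t *\<^sub>R u + t *\<^sub>R v"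
      and "x + a' *\<^sub>R v + b' *\<^sub>R u = x + b' *\<^sub>R u + a' *\<^sub>R v"
      by (simp_all add: add_ac)
    note 2 = 2[unfolded this]
    have "t\<^sup>2 * Duv u v (x + a *\<^sub>R u + b *\<^sub>R v) = t\<^sup>2 * Duv v u (x + b' *\<^sub>R u + a' *\<^sub>R v)"
      using 1 2 by linarith
    then have "Duv u v (x + a *\<^sub>R u + b *\<^sub>R v) = Duv v u (x + b' *\<^sub>R u + a' *\<^sub>R v)"
      using t by simp
    moreover have "\<bar>Duv u v (x + a *\<^sub>R u + b *\<^sub>R v) - Duv u v x\<bar> < e"
      using near[OF ab] by (intro d1) (simp add: d_def)
    moreover have "\<bar>Duv v u (x + b' *\<^sub>R u + a' *\<^sub>R v) - Duv v u x\<bar> < e"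
      using near[OF ab'(3,4,1,2)] by (intro d2) (simp add: d_def)
    ultimately show ?thesis by linarith
  qed
  from this[of "\<bar>Duv u v x - Duv v u x\<bar> / 2"] have "Duv u v x = Duv v u x"
    by (cases "Duv u v x = Duv v u x") auto
  then show ?thesis by (simp add: Duv_def)
qed

section \<open>Vertical derivatives and linear systems\<close>

lemma smooth_on_vd: "smooth_on S f \<Longrightarrow> smooth_on S (vd i f)"
  using smooth_on_frechet_derivative[of S f "axis i 1"] by (simp add: vd_def[abs_def])

lemma vd_eq: "(f has_derivative f') (at y) \<Longrightarrow> vd i f y = f' (axis i 1)"
  by (simp add: vd_def frechet_derivative_eq)

lemma vd_const: "vd i (\<lambda>_. c) y = 0"
  by (simp add: vd_def)

lemma vd_mult:
  assumes "f differentiable (at y)" "g differentiable (at y)"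
  shows "vd i (\<lambda>y. f y * g y) y = f y * vd i g y + vd i f y * g y"
  using vd_eq[OF has_derivative_mult[OF assms[unfolded frechet_derivative_works]], of i]
  by (simp add: vd_def)

lemma vd_sum:
  fixes f :: "'c \<Rightarrow> real^'n \<Rightarrow> real"
  assumes "\<And>a. a \<in> A \<Longrightarrow> f a differentiable (at y)"
  shows "vd i (\<lambda>y. \<Sum>a\<in>A. f a y) y = (\<Sum>a\<in>A. vd i (f a) y)"
proof -
  have "((\<lambda>y. \<Sum>a\<in>A. f a y) has_derivative (\<lambda>v. \<Sum>a\<in>A. frechet_derivative (f a) (at y) v)) (at y)"
    using assms by (intro has_derivative_sum) (simp flip: frechet_derivative_works)
  then show ?thesis by (simp add: vd_eq) (simp add: vd_def)
qed

lemma has_derivative_vec_nth: "((\<lambda>y. y $ j) has_derivative (\<lambda>v. v $ j)) (at y)"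
  by (rule bounded_linear_imp_has_derivative[OF bounded_linear_vec_nth])

lemma vd_component: "vd i (\<lambda>y. y $ j) y = (if i = j then 1 else 0)"
  using vd_eq[OF has_derivative_vec_nth[of j], of i] by (simp add: axis_def)

lemma vd_cong:
  assumes "f differentiable (at y)" "open S" "y \<in> S" "\<And>z. z \<in> S \<Longrightarrow> f z = g z"
  shows "vd i f y = vd i g y"
  unfolding vd_def using frechet_derivative_transform_within_open[OF assms] by simp

lemma vd_eq_0:
  assumes "open S" "y \<in> S" "\<And>z. z \<in> S \<Longrightarrow> f z = 0"
  shows "vd i f y = 0"
  using vd_cong[of "\<lambda>_. 0" y S f i] assms by (simp add: vd_def)

lemma frechet_derivative_eq_sum_vd:
  assumes "f differentiable (at y)"
  shows "frechet_derivative f (at y) v = (\<Sum>j\<in>UNIV. v $ j * vd j f y)"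
proof -
  interpret linear "frechet_derivative f (at y)"
    using assms by (rule linear_frechet_derivative)
  have "frechet_derivative f (at y) v = frechet_derivative f (at y) (\<Sum>j\<in>UNIV. v $ j *\<^sub>R axis j 1)"
    using basis_expansion[of v] by (simp add: scalar_mult_eq_scaleR)
  also have "\<dots> = (\<Sum>j\<in>UNIV. v $ j * vd j f y)"
    by (simp add: sum scale vd_def)
  finally show ?thesis .
qed

lemma differentiable_prod:
  fixes f :: "'i \<Rightarrow> 'a::real_normed_vector \<Rightarrow> real"
  assumes "\<And>i. i \<in> I \<Longrightarrow> f i differentiable (at x)"
  shows "(\<lambda>x. \<Prod>i\<in>I. f i x) differentiable (at x)"
proof -
  have "((\<lambda>x. \<Prod>i\<in>I. f i x) has_derivative
      (\<lambda>v. \<Sum>i\<in>I. frechet_derivative (f i) (at x) v * (\<Prod>j\<in>I - {i}. f j x))) (at x)"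
    using assms by (intro has_derivative_prod) (simp flip: frechet_derivative_works)
  then show ?thesis by (rule differentiableI)
qed

lemma differentiable_det:
  fixes A :: "'a::real_normed_vector \<Rightarrow> real^'n^'n"
  assumes "\<And>i j. (\<lambda>x. A x $ i $ j) differentiable (at x)"
  shows "(\<lambda>x. det (A x)) differentiable (at x)"
  unfolding det_def
  by (intro differentiable_sum ballI differentiable_mult differentiable_const differentiable_prod assms) simp

text \<open>By Cramer's rule the solution is a quotient of determinants. It is applied to \<open>b\<^sup>h\<close>, the
  solution of \<open>g\<^sub>r\<^sub>h b\<^sup>h = b\<^sub>r\<close>, and spares differentiating the inverse matrix \<open>g\<^sup>i\<^sup>j\<close>.\<close>

lemma differentiable_linear_system_solution:
  fixes A :: "'a::real_normed_vector \<Rightarrow> real^'n^'n"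
  assumes A: "\<And>i j. (\<lambda>x. A x $ i $ j) differentiable (at x)"
    and S: "open S" "x \<in> S"
    and inv: "\<And>z. z \<in> S \<Longrightarrow> invertible (A z)"
    and u: "\<And>z. z \<in> S \<Longrightarrow> A z *v u z = b"
  shows "(\<lambda>x. u x $ k) differentiable (at x)"
proof -
  let ?N = "\<lambda>x. det (\<chi> i j. if j = k then b $ i else A x $ i $ j)"
  have nz: "det (A z) \<noteq> 0" if "z \<in> S" for z
    using inv[OF that] by (simp add: invertible_det_nz)
  have "(\<lambda>x. ?N x / det (A x)) differentiable (at x)"
  proof (intro differentiable_divide differentiable_det)
    show "(\<lambda>x. (\<chi> i j. if j = k then b $ i else A x $ i $ j) $ i $ j) differentiable (at x)" for i j
      by (cases "j = k") (auto simp: A)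
  qed (auto simp: A nz S)
  then obtain D where "((\<lambda>x. ?N x / det (A x)) has_derivative D) (at x)"
    by (auto simp: differentiable_def)
  moreover have "?N z / det (A z) = u z $ k" if "z \<in> S" for z
    using u[OF that] unfolding cramer[OF nz[OF that]] by simp
  ultimately have "((\<lambda>x. u x $ k) has_derivative D) (at x)"
    by (rule has_derivative_transform_within_open[OF _ S])
  then show ?thesis by (rule differentiableI)
qed

lemma matrix_inv_right:
  fixes A :: "real^'n^'n"
  assumes "invertible A"
  shows "A ** matrix_inv A = mat 1"
  using assms unfolding invertible_def matrix_inv_def by (rule someI2_ex) blast

section \<open>The metric on a single fibre\<close>

text \<open>The restriction of a Finsler function to one tangent space, in coordinates: everything in the
  proof happens at a fixed point of the manifold, on the open cone \<open>U\<close> of admissible directions.\<close>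

locale finsler_fibre =
  fixes F :: "real^'n \<Rightarrow> real" and U :: "(real^'n) set"
  assumes open_U: "open U"
    and smooth_F: "smooth_on U F"
    and F_pos: "y \<in> U \<Longrightarrow> F y > 0"
    and cone: "y \<in> U \<Longrightarrow> t > 0 \<Longrightarrow> t *\<^sub>R y \<in> U"
    and homogeneous: "y \<in> U \<Longrightarrow> t > 0 \<Longrightarrow> F (t *\<^sub>R y) = t * F y"
    and nondegenerate: "y \<in> U \<Longrightarrow> invertible (g_mat F y)"
begin

lemma smooth_l_low: "smooth_on U (l_low F i)"
  using smooth_on_vd[OF smooth_F] by (simp add: l_low_def[abs_def])

lemma smooth_g_low: "smooth_on U (g_low F i j)"
  unfolding g_low_def[abs_def] power2_eq_square
  by (intro smooth_on_mult smooth_on_const smooth_on_vd[of U "vd j _"]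
      smooth_on_vd[of U "\<lambda>z. F z * F z"] smooth_F open_U)

lemma smooth_C_low: "smooth_on U (C_low F i j k)"
  unfolding C_low_def[abs_def]
  by (intro smooth_on_mult smooth_on_const smooth_on_vd smooth_g_low open_U)

text \<open>Writing the metric through \<open>l\<^sub>j\<close> reduces both its symmetry and the identity \<open>y\<^sub>i = L l\<^sub>i\<close>
  to facts about the first derivatives of \<open>L\<close>.\<close>

lemma g_low_eq:
  assumes y: "y \<in> U"
  shows "g_low F i j y = l_low F i y * l_low F j y + F y * vd i (l_low F j) y"
proof -
  have *: "vd j (\<lambda>z. (F z)\<^sup>2) z = 2 * (F z * l_low F j z)" if "z \<in> U" for z
    using that by (simp add: power2_eq_square vd_mult smooth_on_imp_differentiable[OF smooth_F that] l_low_def)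
  have "vd i (vd j (\<lambda>z. (F z)\<^sup>2)) y = vd i (\<lambda>z. 2 * (F z * l_low F j z)) y"
    by (rule vd_cong[OF _ open_U y *])
       (auto simp: power2_eq_square
         intro!: smooth_on_imp_differentiable[OF _ y] smooth_on_vd smooth_on_mult smooth_F open_U)
  also have "\<dots> = 2 * vd i (\<lambda>z. F z * l_low F j z) y"
    using smooth_on_imp_differentiable[OF _ y]
    by (subst vd_mult) (auto simp: vd_const intro!: smooth_on_mult smooth_F smooth_l_low open_U)
  also have "vd i (\<lambda>z. F z * l_low F j z) y = F y * vd i (l_low F j) y + vd i F y * l_low F j y"
    by (intro vd_mult smooth_on_imp_differentiable[OF _ y] smooth_F smooth_l_low)
  finally show ?thesis by (simp add: g_low_def l_low_def)
qed

lemma g_low_sym: "y \<in> U \<Longrightarrow> g_low F i j y = g_low F j i y"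
  using second_derivative_symmetric[OF open_U smooth_F, of y "axis j 1" "axis i 1"]
  by (simp add: g_low_eq mult.commute l_low_def[abs_def] vd_def[abs_def])

lemma C_low_sym: "y \<in> U \<Longrightarrow> C_low F i j k y = C_low F j i k y"
  unfolding C_low_def
  using vd_cong[OF smooth_on_imp_differentiable[OF smooth_g_low] open_U _ g_low_sym, of y k i j] by simp

text \<open>Euler's relation, from differentiating \<open>L(t y) = t L(y)\<close> at \<open>t = 1\<close>.\<close>

lemma euler:
  assumes y: "y \<in> U"
  shows "(\<Sum>j\<in>UNIV. y $ j * l_low F j y) = F y"
proof -
  have "((\<lambda>t. t *\<^sub>R y) has_derivative (\<lambda>t. t *\<^sub>R y)) (at (1::real))"
    by (auto intro!: derivative_eq_intros)
  moreover have "(F has_derivative frechet_derivative F (at y)) (at (1 *\<^sub>R y))"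
    using smooth_on_imp_differentiable[OF smooth_F y] by (simp flip: frechet_derivative_works)
  ultimately have "((\<lambda>t. F (t *\<^sub>R y)) has_derivative (\<lambda>t. frechet_derivative F (at y) (t *\<^sub>R y))) (at 1)"
    by (rule has_derivative_compose)
  moreover have "((\<lambda>t. F (t *\<^sub>R y)) has_derivative (\<lambda>t. t * F y)) (at 1)"
  proof (rule has_derivative_transform_within_open)
    show "((\<lambda>t. t * F y) has_derivative (\<lambda>t. t * F y)) (at 1)"
      by (auto intro!: derivative_eq_intros)
    show "open {0::real<..}" "(1::real) \<in> {0<..}" by auto
  qed (simp add: homogeneous y)
  ultimately have "(\<lambda>t. frechet_derivative F (at y) (t *\<^sub>R y)) = (\<lambda>t. t * F y)"
    by (rule has_derivative_unique)
  from fun_cong[OF this, of 1] show ?thesis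
    by (simp add: frechet_derivative_eq_sum_vd smooth_on_imp_differentiable[OF smooth_F y] l_low_def)
qed

text \<open>Differentiating Euler's relation gives \<open>y\<^sup>j \<partial>l\<^sub>j/\<partial>y\<^sup>i = 0\<close>, which kills the second part of the
  metric when it is contracted with \<open>y\<^sup>j\<close>.\<close>

lemma y_low_eq:
  assumes y: "y \<in> U"
  shows "y_low F i y = F y * l_low F i y"
proof -
  have d: "(\<lambda>z. z $ j * l_low F j z) differentiable (at y)" for j
    using smooth_on_imp_differentiable[OF smooth_l_low y] has_derivative_vec_nth
    by (intro differentiable_mult) (auto simp: differentiable_def)
  have "vd i (\<lambda>z. z $ j * l_low F j z) y = y $ j * vd i (l_low F j) y + (if i = j then l_low F j y else 0)" for j
    using vd_mult[OF differentiableI[OF has_derivative_vec_nth]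
        smooth_on_imp_differentiable[OF smooth_l_low y], of i j j]
    by (simp add: vd_component)
  then have "(\<Sum>j\<in>UNIV. y $ j * vd i (l_low F j) y) + l_low F i y
      = (\<Sum>j\<in>UNIV. vd i (\<lambda>z. z $ j * l_low F j z) y)"
    by (simp add: sum.distrib)
  also have "\<dots> = vd i (\<lambda>z. \<Sum>j\<in>UNIV. z $ j * l_low F j z) y"
    by (simp add: vd_sum d)
  also have "\<dots> = vd i F y"
    by (rule vd_cong[OF _ open_U y euler]) (auto intro: differentiable_sum d)
  finally have *: "(\<Sum>j\<in>UNIV. y $ j * vd i (l_low F j) y) = 0"
    by (simp add: l_low_def)
  have "y_low F i y = l_low F i y * (\<Sum>j\<in>UNIV. y $ j * l_low F j y) + F y * (\<Sum>j\<in>UNIV. y $ j * vd i (l_low F j) y)"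
    using y by (simp add: y_low_def g_low_eq sum_distrib_left sum.distrib algebra_simps)
  then show ?thesis by (simp add: euler[OF y] *)
qed

lemma g_low_b_up:
  assumes "y \<in> U"
  shows "(\<Sum>h\<in>UNIV. g_low F r h y * b_up F b h y) = b $ r"
proof -
  have "(\<chi> h. b_up F b h y) = matrix_inv (g_mat F y) *v b"
    by (simp add: vec_eq_iff b_up_def g_up_def matrix_vector_mult_def)
  then have "g_mat F y *v (\<chi> h. b_up F b h y) = b"
    using matrix_inv_right[OF nondegenerate[OF assms]]
    by (simp add: matrix_vector_mul_assoc)
  then show ?thesis
    by (simp add: vec_eq_iff g_mat_def matrix_vector_mult_def)
qed

lemma b_up_y_low:
  assumes "y \<in> U"
  shows "(\<Sum>h\<in>UNIV. b_up F b h y * y_low F h y) = beta b y"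
proof -
  have "(\<Sum>h\<in>UNIV. b_up F b h y * y_low F h y)
      = (\<Sum>j\<in>UNIV. (\<Sum>h\<in>UNIV. g_low F j h y * b_up F b h y) * y $ j)"
    unfolding y_low_def sum_distrib_left sum_distrib_right
    by (subst sum.swap) (simp add: g_low_sym[OF assms] mult_ac)
  then show ?thesis by (simp add: g_low_b_up assms beta_def)
qed

lemma differentiable_b_up:
  assumes y: "y \<in> U"
  shows "b_up F b h differentiable (at y)"
proof -
  have "(\<lambda>z. (\<chi> h. b_up F b h z) $ h) differentiable (at y)"
  proof (rule differentiable_linear_system_solution[OF _ open_U y nondegenerate])
    show "(\<lambda>z. g_mat F z $ i $ j) differentiable (at y)" for i j
      using smooth_on_imp_differentiable[OF smooth_g_low y] by (simp add: g_mat_def)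
    show "g_mat F z *v (\<chi> h. b_up F b h z) = b" if "z \<in> U" for z
      using g_low_b_up[OF that] by (simp add: vec_eq_iff g_mat_def matrix_vector_mult_def)
  qed
  then show ?thesis by simp
qed

text \<open>\<open>C\<close> vanishes on an open set, hence so do its derivatives.\<close>

lemma C_low_0_imp_T_low_0:
  assumes C: "\<And>i j k y. y \<in> U \<Longrightarrow> C_low F i j k y = 0" and y: "y \<in> U"
  shows "T_low F h i j k y = 0"
proof -
  have "vd k (C_low F h i j) y = 0"
    by (rule vd_eq_0[OF open_U y]) (rule C)
  then show ?thesis
    by (simp add: T_low_def C_vcov_def C y)
qed

end

section \<open>Contraction with the 1-form\<close>

text \<open>At a fixed point of the manifold the form \<open>b\<close> is a constant vector, while \<open>b\<^sup>i\<close> still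
  depends on the direction through the metric.\<close>

locale finsler_fibre_b_condition = finsler_fibre F U for F :: "real^'n \<Rightarrow> real" and U +
  fixes b :: "real^'n"
  assumes b_C_low: "y \<in> U \<Longrightarrow> (\<Sum>i\<in>UNIV. b_up F b i y * C_low F i j k y) = 0"
begin

text \<open>Since \<open>\<partial>g\<^sub>r\<^sub>h/\<partial>y\<^sup>k = 2 C\<^sub>r\<^sub>h\<^sub>k\<close>, differentiating \<open>g\<^sub>r\<^sub>h b\<^sup>h = b\<^sub>r\<close> and using the b-condition leaves
  \<open>g\<^sub>r\<^sub>h \<partial>b\<^sup>h/\<partial>y\<^sup>k = 0\<close>, and the metric is invertible.\<close>

lemma vd_b_up:
  assumes y: "y \<in> U"
  shows "vd k (b_up F b h) y = 0"
proof -
  have d: "(\<lambda>z. g_low F r h z * b_up F b h z) differentiable (at y)" for r h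
    by (intro differentiable_mult differentiable_b_up smooth_on_imp_differentiable[OF smooth_g_low] y)
  have "(\<Sum>h\<in>UNIV. g_low F r h y * vd k (b_up F b h) y) = 0" for r
  proof -
    have "0 = vd k (\<lambda>_. b $ r) y" by (simp add: vd_def)
    also have "\<dots> = vd k (\<lambda>z. \<Sum>h\<in>UNIV. g_low F r h z * b_up F b h z) y"
      by (rule vd_cong[OF _ open_U y]) (auto simp: g_low_b_up)
    also have "\<dots> = (\<Sum>h\<in>UNIV. g_low F r h y * vd k (b_up F b h) y)
        + 2 * (\<Sum>h\<in>UNIV. b_up F b h y * C_low F r h k y)"
      using y by (simp add: vd_sum d vd_mult differentiable_b_up smooth_on_imp_differentiable[OF smooth_g_low]
          C_low_def sum.distrib sum_distrib_left mult_ac)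
    also have "(\<Sum>h\<in>UNIV. b_up F b h y * C_low F r h k y) = 0"
      using b_C_low[OF y, of r k] by (simp add: C_low_sym[OF y, of r])
    finally show ?thesis by simp
  qed
  then have "g_mat F y *v (\<chi> h. vd k (b_up F b h) y) = 0"
    by (simp add: vec_eq_iff g_mat_def matrix_vector_mult_def)
  then have "(\<chi> h. vd k (b_up F b h) y) = 0"
    using nondegenerate[OF y] unfolding invertible_def
    by (metis matrix_vector_mul_assoc matrix_vector_mul_lid matrix_vector_mult_0_right)
  then show ?thesis by (simp add: vec_eq_iff)
qed

text \<open>As \<open>b\<^sup>h\<close> has vanishing vertical derivatives, the b-condition can be differentiated under the
  contraction.\<close>

lemma b_vd_C_low:
  assumes y: "y \<in> U"
  shows "(\<Sum>h\<in>UNIV. b_up F b h y * vd k (C_low F h i j) y) = 0"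
proof -
  have d: "(\<lambda>z. b_up F b h z * C_low F h i j z) differentiable (at y)" for h
    by (intro differentiable_mult differentiable_b_up smooth_on_imp_differentiable[OF smooth_C_low] y)
  have "0 = vd k (\<lambda>z. \<Sum>h\<in>UNIV. b_up F b h z * C_low F h i j z) y"
    by (rule vd_eq_0[OF open_U y, symmetric]) (rule b_C_low)
  also have "\<dots> = (\<Sum>h\<in>UNIV. b_up F b h y * vd k (C_low F h i j) y)"
    using y by (simp add: vd_sum d vd_mult differentiable_b_up smooth_on_imp_differentiable[OF smooth_C_low] vd_b_up)
  finally show ?thesis by simp
qed

lemma b_C_up:
  assumes y: "y \<in> U"
  shows "(\<Sum>h\<in>UNIV. b_up F b h y * C_up F m h k y) = 0"
proof -
  have "(\<Sum>h\<in>UNIV. b_up F b h y * C_up F m h k y)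
      = (\<Sum>r\<in>UNIV. g_up F m r y * (\<Sum>h\<in>UNIV. b_up F b h y * C_low F h r k y))"
    unfolding C_up_def sum_distrib_left
    by (subst sum.swap) (simp add: C_low_sym[OF y] mult_ac)
  then show ?thesis by (simp add: b_C_low y)
qed

text \<open>Every term of the T-tensor in which \<open>h\<close> is an index of a factor \<open>C\<close>, differentiated or not,
  dies under contraction with \<open>b\<^sup>h\<close>. Only \<open>C\<^sub>i\<^sub>j\<^sub>k l\<^sub>h\<close> survives, and \<open>L l\<^sub>h b\<^sup>h = y\<^sub>h b\<^sup>h = \<beta>\<close>.\<close>

lemma b_T_low:
  assumes y: "y \<in> U"
  shows "(\<Sum>h\<in>UNIV. b_up F b h y * T_low F h i j k y) = beta b y / F y * C_low F i j k y"
proof -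
  let ?B = "\<lambda>h. b_up F b h y"
  have contract: "(\<Sum>h\<in>UNIV. ?B h * (\<Sum>m\<in>UNIV. X h m * Y m)) = 0"
    if "\<And>m. (\<Sum>h\<in>UNIV. ?B h * X h m) = 0" for X :: "'n \<Rightarrow> 'n \<Rightarrow> real" and Y
  proof -
    have "(\<Sum>h\<in>UNIV. ?B h * (\<Sum>m\<in>UNIV. X h m * Y m)) = (\<Sum>m\<in>UNIV. (\<Sum>h\<in>UNIV. ?B h * X h m) * Y m)"
      unfolding sum_distrib_left sum_distrib_right by (subst sum.swap) (simp add: mult_ac)
    then show ?thesis by (simp add: that)
  qed
  have 1: "(\<Sum>h\<in>UNIV. ?B h * (\<Sum>m\<in>UNIV. C_low F m i j y * C_up F m h k y)) = 0"
    using contract[of "\<lambda>h m. C_up F m h k y" "\<lambda>m. C_low F m i j y"] b_C_up[OF y]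
    by (simp add: mult.commute)
  have 2: "(\<Sum>h\<in>UNIV. ?B h * (\<Sum>m\<in>UNIV. C_low F h m j y * C_up F m i k y)) = 0"
    and 3: "(\<Sum>h\<in>UNIV. ?B h * (\<Sum>m\<in>UNIV. C_low F h i m y * C_up F m j k y)) = 0"
    by (rule contract, rule b_C_low[OF y])+
  have v: "(\<Sum>h\<in>UNIV. ?B h * C_vcov F h i j k y) = 0"
    using b_vd_C_low[OF y, of k i j] 1 2 3
    by (simp add: C_vcov_def right_diff_distrib sum_subtractf)
  have "(\<Sum>h\<in>UNIV. ?B h * l_low F h y) = (\<Sum>h\<in>UNIV. ?B h * y_low F h y) / F y"
    using F_pos[OF y] by (simp add: y_low_eq[OF y] sum_divide_distrib)
  then have l: "(\<Sum>h\<in>UNIV. ?B h * l_low F h y) = beta b y / F y"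
    by (simp add: b_up_y_low[OF y])
  have "(\<Sum>h\<in>UNIV. ?B h * T_low F h i j k y)
      = F y * (\<Sum>h\<in>UNIV. ?B h * C_vcov F h i j k y)
        + (\<Sum>h\<in>UNIV. ?B h * C_low F h i j y) * l_low F k y
        + (\<Sum>h\<in>UNIV. ?B h * C_low F h i k y) * l_low F j y
        + (\<Sum>h\<in>UNIV. ?B h * C_low F h j k y) * l_low F i y
        + C_low F i j k y * (\<Sum>h\<in>UNIV. ?B h * l_low F h y)"
    by (simp add: T_low_def distrib_left sum.distrib sum_distrib_left sum_distrib_right mult_ac)
  then show ?thesis by (simp add: v b_C_low[OF y] l)
qed

text \<open>The contraction gives \<open>\<beta> C\<^sub>i\<^sub>j\<^sub>k = 0\<close> throughout \<open>U\<close>. In the directions where \<open>\<beta>\<close> vanishes this says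
  nothing by itself, but its derivative along a coordinate \<open>r\<close> with \<open>b\<^sub>r \<noteq> 0\<close> is there
  \<open>b\<^sub>r C\<^sub>i\<^sub>j\<^sub>k = 0\<close>.\<close>

lemma T_low_0_imp_C_low_0:
  assumes b: "b \<noteq> 0" and T: "\<And>h i j k y. y \<in> U \<Longrightarrow> T_low F h i j k y = 0" and y: "y \<in> U"
  shows "C_low F i j k y = 0"
proof -
  have \<beta>C: "beta b z * C_low F i j k z = 0" if "z \<in> U" for z
    using b_T_low[OF that, of i j k] T[OF that] F_pos[OF that] by simp
  show ?thesis
  proof (cases "beta b y = 0")
    case False
    then show ?thesis using \<beta>C[OF y] by simp
  next
    case True
    obtain r where r: "b $ r \<noteq> 0" using b by (auto simp: vec_eq_iff)
    have "(beta b has_derivative beta b) (at y)"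
      unfolding beta_def[abs_def]
      by (auto intro!: derivative_eq_intros has_derivative_vec_nth simp: mult.commute)
    then have "beta b differentiable (at y)" "vd r (beta b) y = b $ r"
      by (auto simp: differentiable_def vd_eq beta_def axis_def if_distrib cong: if_cong)
    then have "vd r (\<lambda>z. beta b z * C_low F i j k z) y = b $ r * C_low F i j k y"
      by (simp add: vd_mult smooth_on_imp_differentiable[OF smooth_C_low y] True)
    moreover have "vd r (\<lambda>z. beta b z * C_low F i j k z) y = 0"
      by (rule vd_eq_0[OF open_U y]) (rule \<beta>C)
    ultimately show ?thesis using r by simp
  qed
qed

end

section \<open>Fibres in charts\<close>

context
  fixes M :: "'a topology" and \<A> :: "('a, 'n::finite) chart set"
    and D :: "('a \<times> ('a, 'n) tvec) set" and L :: "'a \<Rightarrow> ('a, 'n) tvec \<Rightarrow> real"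
  assumes FS: "finsler_space M \<A> D L"
begin

lemma chart_inv_eq:
  assumes c: "c \<in> charts_at \<A> p"
  shows "chart_inv c (snd c p) = p"
proof -
  have "c \<in> \<A>" and p: "p \<in> fst c"
    using c by (auto simp: charts_at_def)
  then have "openin M (fst c)" "homeomorphic_map (subtopology M (fst c)) (top_of_set (snd c ` fst c)) (snd c)"
    using FS by (auto simp: finsler_space_def smooth_manifold_def case_prod_beta)
  then have "inj_on (snd c) (fst c)"
    using homeomorphic_imp_injective_map openin_subset topspace_subtopology_subset by metis
  then show ?thesis using p by (simp add: chart_inv_def)
qed

lemma linear_jac:
  assumes "c \<in> charts_at \<A> p" "c' \<in> charts_at \<A> p"
  shows "linear (jac c c' p)"
proof -
  have "smooth_on (snd c ` (fst c \<inter> fst c')) (transition c c')"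
    using assms FS unfolding charts_at_def finsler_space_def smooth_manifold_def by blast
  then have "transition c c' differentiable (at (snd c p))"
    using assms by (intro smooth_on_imp_differentiable) (auto simp: charts_at_def)
  then show ?thesis
    unfolding jac_def by (rule linear_frechet_derivative)
qed

text \<open>The transition map from a chart to itself is the identity only on the image of the chart, which
  is why the openness of this image enters.\<close>

lemma jac_self:
  assumes c: "c \<in> charts_at \<A> p"
  shows "jac c c p y = y"
proof -
  have "open (snd c ` fst c)" "snd c p \<in> snd c ` fst c"
    using c FS by (auto simp: charts_at_def finsler_space_def smooth_manifold_def case_prod_beta)
  then have "(transition c c has_derivative (\<lambda>y. y)) (at (snd c p))"
    by (rule has_derivative_transform_within_open[OF has_derivative_ident])
       (simp add: transition_def chart_inv_def f_inv_into_f)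
  then show ?thesis by (simp add: jac_def frechet_derivative_eq)
qed

lemma tvec_of_component:
  "c \<in> charts_at \<A> p \<Longrightarrow> tvec_of \<A> c p y c = y"
  by (simp add: tvec_of_def jac_self)

lemma tvec_of_tangent:
  assumes "(p, v) \<in> D" "c \<in> charts_at \<A> p"
  shows "tvec_of \<A> c p (v c) = v"
proof -
  have "v \<in> tangent_space \<A> p"
    using FS assms(1) by (auto simp: finsler_space_def slit_tangent_bundle_def)
  then have "\<forall>c\<in>charts_at \<A> p. \<forall>c'\<in>charts_at \<A> p. v c' = jac c c' p (v c)"
    and 0: "\<forall>c. c \<notin> charts_at \<A> p \<longrightarrow> v c = 0"
    unfolding tangent_space_def mem_Collect_eq by - (erule conjunct1, erule conjunct2)
  then have 1: "jac c c' p (v c) = v c'" if "c' \<in> charts_at \<A> p" for c'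
    using assms(2) that by metis
  show ?thesis
    unfolding tvec_of_def
  proof (rule ext)
    show "(if c' \<in> charts_at \<A> p then jac c c' p (v c) else 0) = v c'" for c'
      using 0[rule_format, of c'] 1[of c'] by (cases "c' \<in> charts_at \<A> p") simp_all
  qed
qed

lemma tvec_of_scaleR:
  "c \<in> charts_at \<A> p \<Longrightarrow> tvec_of \<A> c p (t *\<^sub>R y) = (\<lambda>c'. t *\<^sub>R tvec_of \<A> c p y c')"
  by (auto simp: tvec_of_def linear_scale[OF linear_jac])

lemma finsler_fibre_in_chart:
  assumes c: "c \<in> charts_at \<A> p"
  shows "finsler_fibre (fibre_rep \<A> L c p) {y. (p, tvec_of \<A> c p y) \<in> D}"
    (is "finsler_fibre ?F ?U")
proof -
  have cA: "c \<in> \<A>" and p: "p \<in> fst c"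
    using c by (auto simp: charts_at_def)
  let ?W = "bundle_coords \<A> D c"
  have W: "open ?W" and smooth: "smooth_on ?W (\<lambda>(x, y). fibre_rep \<A> L c (chart_inv c x) y)"
    using FS cA by (auto simp: finsler_space_def)
  have U: "?U = {y. (snd c p, y) \<in> ?W}"
    using p by (simp add: bundle_coords_def chart_inv_eq[OF c])
  have cone: "(p, \<lambda>c. t *\<^sub>R v c) \<in> D \<and> L p (\<lambda>c. t *\<^sub>R v c) = t * L p v"
    if "(p, v) \<in> D" "t > 0" for v and t :: real
    using FS that by (auto simp: finsler_space_def)
  show ?thesis
  proof
    show "open ?U"
      unfolding U using open_vimage[OF W, of "Pair (snd c p)"]
      by (simp add: vimage_def continuous_on_Pair)
    show "smooth_on ?U ?F"
      using Ck_on_section[OF W, of _ "\<lambda>(x, y). fibre_rep \<A> L c (chart_inv c x) y" "snd c p"] smooth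
      unfolding U smooth_on_def by (simp add: chart_inv_eq[OF c])
    fix y assume y: "y \<in> ?U"
    show "?F y > 0"
      using FS y by (auto simp: finsler_space_def fibre_rep_def)
    have "invertible (g_mat ?F (tvec_of \<A> c p y c))"
      using FS y c by (auto simp: finsler_space_def)
    then show "invertible (g_mat ?F y)"
      by (simp add: tvec_of_component[OF c])
    fix t :: real assume "t > 0"
    then show "t *\<^sub>R y \<in> ?U" "?F (t *\<^sub>R y) = t * ?F y"
      using cone y by (auto simp: tvec_of_scaleR[OF c] fibre_rep_def)
  qed
qed

text \<open>Components in one chart at \<open>p\<close> determine the tangent vector, so conditions on all admissible
  vectors at \<open>p\<close> are conditions on the component vectors in an open cone.\<close>

lemma all_D_iff_all_fibre:
  assumes "c \<in> charts_at \<A> p"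
  shows "(\<forall>v. (p, v) \<in> D \<longrightarrow> P (v c)) \<longleftrightarrow> (\<forall>y. (p, tvec_of \<A> c p y) \<in> D \<longrightarrow> P y)"
  using tvec_of_component[OF assms] tvec_of_tangent[OF _ assms] by metis

end

section \<open>The equivalence\<close>

theorem theorem4p7:
  fixes M :: "'a topology"
    and \<A> :: "('a, 'n::finite) chart set"
    and D :: "('a \<times> ('a, 'n) tvec) set"
    and L :: "'a \<Rightarrow> ('a, 'n) tvec \<Rightarrow> real"
    and b :: "'a \<Rightarrow> ('a, 'n) chart \<Rightarrow> real^'n"
  assumes "finsler_space M \<A> D L"
    and "smooth_one_form \<A> b"
    and "\<forall>p\<in>topspace M. \<exists>v. (p, v) \<in> D \<and> m_nonzero_at \<A> L b p v"
    and "b_condition \<A> D L b"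
  shows "riemannian \<A> D L \<longleftrightarrow> T_tensor_vanishes \<A> D L"
proof -
  have "(\<forall>v. (p, v) \<in> D \<longrightarrow> (\<forall>i j k. C_low (fibre_rep \<A> L c p) i j k (v c) = 0)) \<longleftrightarrow>
        (\<forall>v. (p, v) \<in> D \<longrightarrow> (\<forall>h i j k. T_low (fibre_rep \<A> L c p) h i j k (v c) = 0))"
    if p: "p \<in> topspace M" and c: "c \<in> charts_at \<A> p" for p c
  proof -
    let ?F = "fibre_rep \<A> L c p" and ?U = "{y. (p, tvec_of \<A> c p y) \<in> D}"
    interpret finsler_fibre ?F ?U
      by (rule finsler_fibre_in_chart[OF assms(1) c])
    interpret finsler_fibre_b_condition ?F ?U "b p c"
    proof
      fix y j k assume "y \<in> ?U"
      then show "(\<Sum>i\<in>UNIV. b_up ?F (b p c) i y * C_low ?F i j k y) = 0"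
        using assms(4) c tvec_of_component[OF assms(1) c, of y]
        by (fastforce simp: b_condition_def)
    qed
    obtain v i where "m_low ?F (b p c) i (v c) \<noteq> 0"
      using assms(3) p c unfolding m_nonzero_at_def by blast
    \<comment> \<open>If \<open>b\<close> vanished at \<open>p\<close>, then \<open>\<beta> = 0\<close> and every \<open>m\<^sub>i\<close> would be \<open>0\<close>.\<close>
    then have "b p c \<noteq> 0"
      by (auto simp: m_low_def beta_def)
    then have "(\<forall>y. y \<in> ?U \<longrightarrow> (\<forall>i j k. C_low ?F i j k y = 0)) \<longleftrightarrow>
        (\<forall>y. y \<in> ?U \<longrightarrow> (\<forall>h i j k. T_low ?F h i j k y = 0))"
      using C_low_0_imp_T_low_0 T_low_0_imp_C_low_0 by blast
    then show ?thesis
      using all_D_iff_all_fibre[OF assms(1) c, where P = "\<lambda>y. \<forall>i j k. C_low ?F i j k y = 0"]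
        all_D_iff_all_fibre[OF assms(1) c, where P = "\<lambda>y. \<forall>h i j k. T_low ?F h i j k y = 0"]
      by simp
  qed
  moreover have "p \<in> topspace M" if "(p, v) \<in> D" for p v
    using assms(1) that by (auto simp: finsler_space_def slit_tangent_bundle_def)
  ultimately show ?thesis
    unfolding riemannian_def T_tensor_vanishes_def by blast
qed

end
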